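(* Let $A$ be a unital complex Banach algebra and let $a\in A$ be such that its Moore-Penrose inverse $a^{\dag}$ exists. Then, for each one of the statements (i)--(iii) below, $a$ is EP if and only if that statement holds: (i) $a^2a^{\dag}+a^{\dag}a^2=2a$; (ii) $(a^{\dag})^2a+a(a^{\dag})^2=2a^{\dag}$; (iii) the group inverse $a^{\sharp}$ exists and $a^{\dag}a^{\sharp}a+aa^{\sharp}a^{\dag}=2a^{\dag}$.
   Context: Let $A$ be a unital complex Banach algebra. An element $h\in A$ is hermitian if $\|\exp(ith)\|=1$ for all $t\in\mathbb{R}$. Given $a\in A$, an element $x\in A$ is the Moore-Penrose inverse of $a$, denoted $a^{\dag}$, if $a=axa$, $x=xax$, and both $ax$ and $xa$ are hermitian; there is at most one such $x$. An element $b\in A$ is the group inverse of $a$, denoted $a^{\sharp}$, if $a=aba$, $b=bab$ and $ab=ba$; it is unique if it exists. An element $a\in A$ is EP if $a^{\dag}$ exists and $aa^{\dag}=a^{\dag}a$. *)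

theory Defs
  imports Complex_Main
begin

text \<open>
  The library has real Banach algebras only. A complex one is a real one together with a compatible
  complex scalar multiplication that commutes with multiplication in each argument and for which the
  norm is homogeneous. The parent class \<^class>\<open>real_normed_algebra_1\<close> imposes
  \<open>norm 1 = 1\<close>. This loses nothing: if \<open>norm 1 \<noteq> 1\<close>, then
  \<open>t = 0\<close> in the definition of hermitian shows that no element is hermitian, and so no
  element has a Moore-Penrose inverse.
\<close>

class complex_banach_algebra_1 = real_normed_algebra_1 + banach +
  fixes scaleC :: "complex \<Rightarrow> 'a \<Rightarrow> 'a" (infixr "*\<^sub>C" 75)
  assumes scaleC_add_right: "c *\<^sub>C (x + y) = c *\<^sub>C x + c *\<^sub>C y"
    and scaleC_add_left: "(c + d) *\<^sub>C x = c *\<^sub>C x + d *\<^sub>C x"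
    and scaleC_scaleC: "c *\<^sub>C d *\<^sub>C x = (c * d) *\<^sub>C x"
    and scaleC_of_real: "complex_of_real r *\<^sub>C x = r *\<^sub>R x"
    and mult_scaleC_left: "(c *\<^sub>C x) * y = c *\<^sub>C (x * y)"
    and mult_scaleC_right: "x * (c *\<^sub>C y) = c *\<^sub>C (x * y)"
    and norm_scaleC: "norm (c *\<^sub>C x) = cmod c * norm x"

instantiation complex :: complex_banach_algebra_1
begin

definition scaleC_complex :: "complex \<Rightarrow> complex \<Rightarrow> complex" where
  "scaleC_complex c x = c * x"

instance
  by standard (auto simp: scaleC_complex_def algebra_simps norm_mult scaleR_conv_of_real)

end

definition hermitian_elem :: "'a::complex_banach_algebra_1 \<Rightarrow> bool" where
  "hermitian_elem h \<longleftrightarrow> (\<forall>t::real. norm (exp ((\<i> * complex_of_real t) *\<^sub>C h)) = 1)"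

definition is_mp_inverse :: "'a::complex_banach_algebra_1 \<Rightarrow> 'a \<Rightarrow> bool" where
  "is_mp_inverse a x \<longleftrightarrow>
     a = a * x * a \<and> x = x * a * x \<and> hermitian_elem (a * x) \<and> hermitian_elem (x * a)"

definition mp_invertible :: "'a::complex_banach_algebra_1 \<Rightarrow> bool" where
  "mp_invertible a \<longleftrightarrow> (\<exists>x. is_mp_inverse a x)"

definition mp_inverse :: "'a::complex_banach_algebra_1 \<Rightarrow> 'a" where
  "mp_inverse a = (THE x. is_mp_inverse a x)"

definition is_group_inverse :: "'a::complex_banach_algebra_1 \<Rightarrow> 'a \<Rightarrow> bool" where
  "is_group_inverse a b \<longleftrightarrow> a = a * b * a \<and> b = b * a * b \<and> a * b = b * a"

definition group_invertible :: "'a::complex_banach_algebra_1 \<Rightarrow> bool" where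
  "group_invertible a \<longleftrightarrow> (\<exists>b. is_group_inverse a b)"

definition group_inverse :: "'a::complex_banach_algebra_1 \<Rightarrow> 'a" where
  "group_inverse a = (THE b. is_group_inverse a b)"

definition EP_elem :: "'a::complex_banach_algebra_1 \<Rightarrow> bool" where
  "EP_elem a \<longleftrightarrow> mp_invertible a \<and> a * mp_inverse a = mp_inverse a * a"

text \<open>Uniqueness of both inverses, so that the definite descriptions above are meaningful.\<close>

lemma is_group_inverse_unique:
  assumes "is_group_inverse a b" "is_group_inverse a c"
  shows "b = c"
proof -
  have b: "a = a * b * a" "b = b * a * b" "a * b = b * a"
    and c: "a = a * c * a" "c = c * a * c" "a * c = c * a"
    using assms unfolding is_group_inverse_def by blast+
  have "a * b = (a * c) * (a * b)"
    using c(1) by (metis mult.assoc)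
  moreover have "a * c = (a * c) * (a * b)"
    using b(1) b(3) c(3) by (metis mult.assoc)
  ultimately have eq: "a * b = a * c" by simp
  have "b = b * (a * c)"
    using b(2) eq by (metis mult.assoc)
  also have "\<dots> = (a * c) * c"
    using b(3) eq by (metis mult.assoc)
  also have "\<dots> = c"
    using c(2) c(3) by metis
  finally show ?thesis .
qed

lemma group_inverse_works: "group_invertible a \<Longrightarrow> is_group_inverse a (group_inverse a)"
  unfolding group_invertible_def group_inverse_def
  by (metis is_group_inverse_unique theI)

lemma exp_scaleC_idempotent:
  fixes p :: "'a::complex_banach_algebra_1"
  assumes p: "p * p = p"
  shows "exp (z *\<^sub>C p) = 1 + (exp z - 1) *\<^sub>C p"
proof -
  have pow: "(z *\<^sub>C p) ^ Suc n = (z ^ Suc n) *\<^sub>C p" for n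
    by (induction n)
      (simp_all add: mult_scaleC_left mult_scaleC_right scaleC_scaleC p mult.commute)
  have lin: "bounded_linear (\<lambda>c. c *\<^sub>C p)"
  proof (rule bounded_linear_intro[where K = "norm p"])
    show "(r *\<^sub>R c) *\<^sub>C p = r *\<^sub>R (c *\<^sub>C p)" for r c
      by (simp only: scaleR_conv_of_real[of r c] scaleC_scaleC[symmetric] scaleC_of_real)
  qed (simp_all add: scaleC_add_left norm_scaleC)
  have "(\<lambda>n. z ^ n /\<^sub>R fact n) sums exp z"
    by (rule exp_converges)
  then have "(\<lambda>n. z ^ Suc n /\<^sub>R fact (Suc n)) sums (exp z - 1)"
    by (subst sums_Suc_iff) simp
  then have "(\<lambda>n. (z ^ Suc n /\<^sub>R fact (Suc n)) *\<^sub>C p) sums ((exp z - 1) *\<^sub>C p)"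
    by (rule bounded_linear.sums[OF lin])
  moreover have "(c /\<^sub>R r) *\<^sub>C p = (c *\<^sub>C p) /\<^sub>R r" for c r
    by (rule linear_scale[OF bounded_linear.linear[OF lin]])
  ultimately have "(\<lambda>n. (z *\<^sub>C p) ^ Suc n /\<^sub>R fact (Suc n)) sums ((exp z - 1) *\<^sub>C p)"
    unfolding pow by (simp only:)
  then have "(\<lambda>n. (z *\<^sub>C p) ^ n /\<^sub>R fact n) sums ((exp z - 1) *\<^sub>C p + 1)"
    by (subst (asm) sums_Suc_iff) simp
  from sums_unique2[OF exp_converges this] show ?thesis
    by (simp add: add.commute)
qed

lemma hermitian_idempotent_reflection:
  fixes p :: "'a::complex_banach_algebra_1"
  assumes "p * p = p" "hermitian_elem p"
  shows "norm (1 - 2 *\<^sub>R p) = 1"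
proof -
  have "exp (\<i> * complex_of_real pi) - 1 = complex_of_real (- 2)"
    by (simp add: mult.commute)
  then have "exp ((\<i> * complex_of_real pi) *\<^sub>C p) = 1 + (- 2) *\<^sub>R p"
    using exp_scaleC_idempotent[OF assms(1)] scaleC_of_real by metis
  also have "\<dots> = 1 - 2 *\<^sub>R p"
    by simp
  finally show ?thesis
    using assms(2) unfolding hermitian_elem_def by metis
qed

lemma square_zero_contraction:
  fixes h :: "'a::real_normed_algebra_1"
  assumes le1: "norm (1 + h) \<le> 1" and h2: "h * h = 0"
  shows "h = 0"
proof -
  have pow: "(1 + h) ^ n = 1 + real n *\<^sub>R h" for n
    by (induction n) (simp_all add: algebra_simps h2)
  have "real n * norm h \<le> 2" for n
  proof -
    have "norm ((1 + h) ^ n) \<le> 1"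
      using norm_power_ineq[of "1 + h" n] power_le_one[OF norm_ge_zero le1, of n] by linarith
    then have "norm (1 + real n *\<^sub>R h) \<le> 1"
      by (simp add: pow)
    then have "norm (real n *\<^sub>R h) \<le> 2"
      using norm_triangle_ineq4[of "1 + real n *\<^sub>R h" 1] by simp
    then show ?thesis by simp
  qed
  then have "\<not> 0 < norm h"
    by (metis linorder_not_le reals_Archimedean3)
  then show ?thesis by simp
qed

lemma hermitian_idempotents_eq:
  fixes p q :: "'a::complex_banach_algebra_1"
  assumes pq: "p * q = q \<and> q * p = p \<or> p * q = p \<and> q * p = q"
    and herm: "hermitian_elem p" "hermitian_elem q"
  shows "p = q"
proof -
  have idem: "p * p = p" "q * q = q"
    using pq by (metis mult.assoc)+
  define r where "r = p * q"
  define h where "h = 4 *\<^sub>R r - 2 *\<^sub>R p - 2 *\<^sub>R q"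
  have "(1 - 2 *\<^sub>R p) * (1 - 2 *\<^sub>R q) = 1 + h"
    unfolding h_def r_def by (simp add: algebra_simps)
  then have "norm (1 + h) \<le> 1"
    using norm_mult_ineq[of "1 - 2 *\<^sub>R p" "1 - 2 *\<^sub>R q"]
      hermitian_idempotent_reflection[OF idem(1) herm(1)]
      hermitian_idempotent_reflection[OF idem(2) herm(2)] by simp
  moreover have h: "h = 2 *\<^sub>R (q - p) \<or> h = 2 *\<^sub>R (p - q)"
  proof -
    have four: "4 *\<^sub>R x = 2 *\<^sub>R x + 2 *\<^sub>R x" for x :: 'a
      by (simp flip: scaleR_left_distrib)
    from pq have "r = q \<or> r = p" unfolding r_def by blast
    then show ?thesis
      unfolding h_def four by (elim disjE) (simp_all add: scaleR_right_diff_distrib)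
  qed
  moreover have "(p - q) * (p - q) = 0" "(q - p) * (q - p) = 0"
    using pq idem by (auto simp: algebra_simps)
  then have "h * h = 0"
    using h by auto
  ultimately have "h = 0"
    by (blast intro: square_zero_contraction)
  then show ?thesis using h by auto
qed

lemma is_mp_inverse_unique:
  assumes "is_mp_inverse a x" "is_mp_inverse a y"
  shows "x = y"
proof -
  have x: "a = a * x * a" "x = x * a * x" "hermitian_elem (a * x)" "hermitian_elem (x * a)"
    and y: "a = a * y * a" "y = y * a * y" "hermitian_elem (a * y)" "hermitian_elem (y * a)"
    using assms unfolding is_mp_inverse_def by blast+
  have "(a * x) * (a * y) = a * y" "(a * y) * (a * x) = a * x"
    using x(1) y(1) by (metis mult.assoc)+
  then have ax: "a * x = a * y"
    using hermitian_idempotents_eq x(3) y(3) by blast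
  have "(x * a) * (y * a) = x * a" "(y * a) * (x * a) = y * a"
    using x(1) y(1) by (metis mult.assoc)+
  then have xa: "x * a = y * a"
    using hermitian_idempotents_eq x(4) y(4) by blast
  have "x = y * (a * x)"
    using x(2) xa by (metis mult.assoc)
  also have "\<dots> = y"
    using y(2) ax by (metis mult.assoc)
  finally show ?thesis .
qed

lemma mp_inverse_works: "mp_invertible a \<Longrightarrow> is_mp_inverse a (mp_inverse a)"
  unfolding mp_invertible_def mp_inverse_def
  by (metis is_mp_inverse_unique theI)

end

theory Submission imports Defs begin

text \<open>
  Write \<open>x\<close> for the Moore-Penrose inverse of \<open>a\<close>. Each of the three equations has the form
  \<open>y * e + f * y = 2 * y\<close> with idempotents \<open>e\<close> and \<open>f\<close>: in the first,
  \<open>y = a\<close>, \<open>e = a * x\<close> and \<open>f = x * a\<close>; in the second, \<open>y = x\<close>,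
  \<open>e = x * a\<close> and \<open>f = a * x\<close>; in the third, \<open>y = x\<close> and both idempotents
  are \<open>a * g\<close>, where \<open>g\<close> is the group inverse. Right multiplication by
  \<open>e\<close> and left multiplication by \<open>f\<close> are commuting projections, so their eigenvalues are
  \<open>0\<close> and \<open>1\<close>, and their sum takes the value \<open>2 * y\<close> at \<open>y\<close>
  only if both fix \<open>y\<close> (lemma \<open>idempotents_fix_if_sum_twice\<close>).

  The two resulting identities \<open>y * e = y\<close> and \<open>f * y = y\<close> then identify
  \<open>a * x\<close> with \<open>x * a\<close>. For the first equation they evaluate the product
  \<open>(x * a) * (a * x)\<close> both as \<open>a * x\<close> and as \<open>x * a\<close>, and for the second
  \<open>(a * x) * (x * a)\<close> likewise; for the third they force both idempotents to equal
  \<open>a * g\<close>. Conversely, if \<open>a * x = x * a\<close>, then \<open>x\<close> is itself the group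
  inverse, and the equations follow from \<open>a = a * x * a\<close> and \<open>x = x * a * x\<close>.
\<close>

text \<open>
  Multiplying the hypothesis by \<open>f\<close> on the left gives \<open>f * y * e = f * y\<close>, multiplying it
  by \<open>e\<close> on the right gives \<open>f * y * e = y * e\<close>. So the two summands agree, and as
  \<open>2\<close> can be cancelled, each equals \<open>y\<close>.
\<close>

lemma idempotents_fix_if_sum_twice:
  fixes e f y :: "'a::real_algebra_1"
  assumes e: "e * e = e" and f: "f * f = f"
    and sum: "y * e + f * y = 2 * y"
  shows "y * e = y" "f * y = y"
proof -
  have "f * (y * e + f * y) = f * y * e + f * y"
    using f by (metis distrib_left mult.assoc)
  then have "f * y * e = f * y"
    by (simp add: sum mult_2 distrib_left)
  moreover have "(y * e + f * y) * e = y * e + f * y * e"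
    using e by (metis distrib_right mult.assoc)
  then have "f * y * e = y * e"
    by (simp add: sum mult_2 distrib_right)
  ultimately have "y * e = f * y"
    by metis
  then have "2 *\<^sub>R (y * e) = 2 *\<^sub>R y" "2 *\<^sub>R (f * y) = 2 *\<^sub>R y"
    using sum by (metis scaleR_2 mult_2)+
  then show "y * e = y" "f * y = y"
    by simp_all
qed

lemma commutes_with_reflexive_inverse_iff:
  fixes a x :: "'a::real_algebra_1"
  assumes a: "a = a * x * a" and x: "x = x * a * x"
  shows "a * x = x * a \<longleftrightarrow> a ^ 2 * x + x * a ^ 2 = 2 * a"
proof
  assume "a * x = x * a"
  then have "a ^ 2 * x = a" "x * a ^ 2 = a"
    using a by (metis mult.assoc power2_eq_square)+
  then show "a ^ 2 * x + x * a ^ 2 = 2 * a"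
    by (simp add: mult_2)
next
  assume "a ^ 2 * x + x * a ^ 2 = 2 * a"
  then have "a * (a * x) + (x * a) * a = 2 * a"
    by (simp add: power2_eq_square mult.assoc)
  moreover have "(a * x) * (a * x) = a * x" "(x * a) * (x * a) = x * a"
    using a x by (metis mult.assoc)+
  ultimately have fixed: "a * (a * x) = a" "(x * a) * a = a"
    using idempotents_fix_if_sum_twice by blast+
  have "a * x = (x * a) * (a * x)"
    using fixed(2) by (metis mult.assoc)
  also have "\<dots> = x * a"
    using fixed(1) by (metis mult.assoc)
  finally show "a * x = x * a" .
qed

text \<open>
  If the equation holds, the idempotent \<open>a * g\<close> fixes \<open>x\<close> on both sides. It also fixes
  \<open>a\<close> on both sides, so \<open>a * x = a * x * a * g = a * g\<close> and, symmetrically,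
  \<open>x * a = g * a = a * g\<close>.
\<close>

lemma commutes_with_reflexive_inverse_if_group_inverse_sum:
  fixes a x g :: "'a::complex_banach_algebra_1"
  assumes a: "a = a * x * a" and g: "is_group_inverse a g"
    and sum: "x * g * a + a * g * x = 2 * x"
  shows "a * x = x * a"
proof -
  have ag: "a = a * g * a" "a * g = g * a"
    using g unfolding is_group_inverse_def by blast+
  have "(a * g) * (a * g) = a * g"
    using ag(1) by (metis mult.assoc)
  moreover have "x * (a * g) + (a * g) * x = 2 * x"
    using sum ag(2) by (simp add: mult.assoc)
  ultimately have fixed: "x * (a * g) = x" "(a * g) * x = x"
    using idempotents_fix_if_sum_twice by blast+
  have "a * x = a * x * a * g"
    using fixed(1) by (simp add: mult.assoc)
  also have "\<dots> = g * a * x * a"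
    using a ag(2) by (metis mult.assoc)
  also have "\<dots> = x * a"
    using fixed(2) ag(2) by (simp add: mult.assoc)
  finally show ?thesis .
qed

theorem theorem2p3:
  fixes a :: "'a::complex_banach_algebra_1"
  assumes "mp_invertible a"
  shows "(EP_elem a \<longleftrightarrow> a ^ 2 * mp_inverse a + mp_inverse a * a ^ 2 = 2 * a) \<and>
    (EP_elem a \<longleftrightarrow> (mp_inverse a) ^ 2 * a + a * (mp_inverse a) ^ 2 = 2 * mp_inverse a) \<and>
    (EP_elem a \<longleftrightarrow> group_invertible a \<and>
       mp_inverse a * group_inverse a * a + a * group_inverse a * mp_inverse a = 2 * mp_inverse a)"
proof -
  define x where "x = mp_inverse a"
  have a: "a = a * x * a" and x: "x = x * a * x"
    using mp_inverse_works[OF assms] unfolding is_mp_inverse_def x_def by blast+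
  have EP: "EP_elem a \<longleftrightarrow> a * x = x * a"
    using assms unfolding EP_elem_def x_def by blast
  have first: "EP_elem a \<longleftrightarrow> a ^ 2 * x + x * a ^ 2 = 2 * a"
    unfolding EP by (rule commutes_with_reflexive_inverse_iff[OF a x])
  \<comment> \<open>The second equation is the first one with the roles of \<open>a\<close> and \<open>x\<close> exchanged.\<close>
  have second: "EP_elem a \<longleftrightarrow> x ^ 2 * a + a * x ^ 2 = 2 * x"
    unfolding EP using commutes_with_reflexive_inverse_iff[OF x a] by metis
  have third: "EP_elem a \<longleftrightarrow> group_invertible a \<and>
      x * group_inverse a * a + a * group_inverse a * x = 2 * x"
  proof
    assume "EP_elem a"
    then have comm: "a * x = x * a"
      unfolding EP .
    then have gx: "is_group_inverse a x"
      using a x unfolding is_group_inverse_def by blast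
    then have inv: "group_invertible a"
      unfolding group_invertible_def by blast
    then have "group_inverse a = x"
      using group_inverse_works gx is_group_inverse_unique by blast
    moreover have "x * x * a = x" "a * x * x = x"
      using x comm by (metis mult.assoc)+
    ultimately show "group_invertible a \<and>
        x * group_inverse a * a + a * group_inverse a * x = 2 * x"
      using inv by (simp add: mult_2)
  next
    assume "group_invertible a \<and> x * group_inverse a * a + a * group_inverse a * x = 2 * x"
    then show "EP_elem a"
      unfolding EP
      using commutes_with_reflexive_inverse_if_group_inverse_sum[OF a group_inverse_works] by blast
  qed
  show ?thesis
    using first second third unfolding x_def by blast
qed

end
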